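(* Let $\mathcal{B}\subset\mathcal{A}$ be a regular unital inclusion of finite-dimensional von Neumann algebras with inclusion matrix $A$. Then $A$ is of depth $2$ (that is, there exists $q\in\mathbb{Z}_+$ with $AA^tA\le qA$), and the constant $q$ in this inequality is bounded below by the square of the norm of the inclusion matrix: any $q$ with $AA^tA\le qA$ satisfies $q\ge\|A\|^2$.
   Context: For $\mathcal{B}=\bigoplus_{j=0}^{r-1}M_{m_j}(\mathbb{C})\subset\mathcal{A}=\bigoplus_{i=0}^{s-1}M_{n_i}(\mathbb{C})$ (unital inclusion), the inclusion matrix is the $s\times r$ matrix $A=[a_{ij}]$ where $a_{ij}$ is the number of times the summand $M_{m_j}$ of $\mathcal{B}$ appears in the summand $M_{n_i}$ of $\mathcal{A}$. The normalizer is $\mathcal{N}_{\mathcal{A}}(\mathcal{B})=\{U\in\mathcal{A}\text{ unitary}:U\mathcal{B}U^*=\mathcal{B}\}$; the inclusion is regular if $\mathcal{A}=\mathrm{span}\,\mathcal{N}_{\mathcal{A}}(\mathcal{B})$. Depth: an $s\times r$ matrix $A$ is of depth $n\ge 2$ if $n$ is the least integer ($\ge2$) for which $A^{n+1}\le qA^{n-1}$ holds for some $q\in\mathbb{Z}_+$, where powers of a rectangular matrix mean $A^1=A$, $A^2=AA^t$, $A^3=AA^tA$, and so forth, and inequalities between matrices are entrywise. $\|A\|$ denotes the operator norm of $A$. *)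

theory Defs
  imports Complex_Main "Jordan_Normal_Form.Schur_Decomposition" "Jordan_Normal_Form.VS_Connect"
begin

text \<open>
  A multi-matrix algebra is represented by block-diagonal complex matrices, so that its elements
  share the operations (sum, product, \<open>mat_adjoint\<close>) of one full matrix algebra.
  The list \<open>ns\<close> contains the sizes of the simple summands.
\<close>

definition blocks :: "nat list \<Rightarrow> complex mat list set" where
  "blocks ns = {bs. length bs = length ns \<and> (\<forall>i<length ns. bs ! i \<in> carrier_mat (ns ! i) (ns ! i))}"

definition multi_matrix_algebra :: "nat list \<Rightarrow> complex mat set" where
  "multi_matrix_algebra ns = diag_block_mat ` blocks ns"

definition unital_star_subalgebra :: "nat \<Rightarrow> complex mat set \<Rightarrow> complex mat set \<Rightarrow> bool" where
  "unital_star_subalgebra N B A \<longleftrightarrow>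
     B \<subseteq> A \<and> A \<subseteq> carrier_mat N N \<and> 1\<^sub>m N \<in> B \<and>
     (\<forall>x\<in>B. \<forall>y\<in>B. x + y \<in> B \<and> x * y \<in> B) \<and>
     (\<forall>c. \<forall>x\<in>B. c \<cdot>\<^sub>m x \<in> B) \<and>
     (\<forall>x\<in>B. mat_adjoint x \<in> B)"

definition star_isomorphism ::
    "(complex mat \<Rightarrow> complex mat) \<Rightarrow> complex mat set \<Rightarrow> complex mat set \<Rightarrow> bool" where
  "star_isomorphism \<phi> X Y \<longleftrightarrow>
     bij_betw \<phi> X Y \<and>
     (\<forall>x\<in>X. \<forall>y\<in>X. \<phi> (x + y) = \<phi> x + \<phi> y \<and> \<phi> (x * y) = \<phi> x * \<phi> y) \<and>
     (\<forall>c. \<forall>x\<in>X. \<phi> (c \<cdot>\<^sub>m x) = c \<cdot>\<^sub>m \<phi> x) \<and>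
     (\<forall>x\<in>X. \<phi> (mat_adjoint x) = mat_adjoint (\<phi> x))"

definition unitary_mat :: "nat \<Rightarrow> complex mat \<Rightarrow> bool" where
  "unitary_mat N U \<longleftrightarrow>
     U \<in> carrier_mat N N \<and> U * mat_adjoint U = 1\<^sub>m N \<and> mat_adjoint U * U = 1\<^sub>m N"

definition normalizer :: "nat \<Rightarrow> complex mat set \<Rightarrow> complex mat set \<Rightarrow> complex mat set" where
  "normalizer N A B =
     {U \<in> A. unitary_mat N U \<and> (\<lambda>b. U * b * mat_adjoint U) ` B = B}"

definition regular_inclusion :: "nat \<Rightarrow> complex mat set \<Rightarrow> complex mat set \<Rightarrow> bool" where
  "regular_inclusion N A B \<longleftrightarrow>
     LinearCombinations.module.span class_ring (module_mat TYPE(complex) N N) (normalizer N A B) = A"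

text \<open>
  \<open>direct_sum_copies a bs\<close> is the block-diagonal matrix in which the block \<open>bs ! j\<close> is repeated
  \<open>a j\<close> times.
\<close>

definition direct_sum_copies :: "(nat \<Rightarrow> nat) \<Rightarrow> complex mat list \<Rightarrow> complex mat" where
  "direct_sum_copies a bs =
     diag_block_mat (concat (map (\<lambda>j. replicate (a j) (bs ! j)) [0..<length bs]))"

text \<open>
  The entry \<open>L $$ (i, j)\<close> of the inclusion matrix counts how often the \<open>j\<close>-th summand of \<open>B\<close> appears
  in the \<open>i\<close>-th summand of the ambient algebra: \<open>\<phi>\<close> identifies \<open>B\<close> with the direct sum of full
  matrix algebras of sizes \<open>ms\<close>, and up to a unitary \<open>U i\<close> the \<open>i\<close>-th component of the inclusion
  is the direct sum, over \<open>j\<close>, of \<open>L $$ (i, j)\<close> copies of the \<open>j\<close>-th summand.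
\<close>

definition is_inclusion_matrix ::
    "nat list \<Rightarrow> nat list \<Rightarrow> complex mat set \<Rightarrow> nat mat \<Rightarrow> bool" where
  "is_inclusion_matrix ns ms B L \<longleftrightarrow>
     L \<in> carrier_mat (length ns) (length ms) \<and>
     (\<forall>i<length ns. (\<Sum>j<length ms. L $$ (i, j) * ms ! j) = ns ! i) \<and>
     (\<exists>\<phi> U. star_isomorphism \<phi> (multi_matrix_algebra ms) B \<and>
        (\<forall>i<length ns. unitary_mat (ns ! i) (U i)) \<and>
        (\<forall>bs\<in>blocks ms. \<phi> (diag_block_mat bs) =
           diag_block_mat (map (\<lambda>i. U i * direct_sum_copies (\<lambda>j. L $$ (i, j)) bs * mat_adjoint (U i))
             [0..<length ns])))"

text \<open>
  Alternating powers \<open>M, M M\<^sup>t, M M\<^sup>t M, \<dots>\<close> of a rectangular matrix; only exponents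
  \<open>\<ge> 1\<close> matter, exponent \<open>0\<close> is the base case of the recursion.
\<close>

primrec alt_pow :: "nat mat \<Rightarrow> nat \<Rightarrow> nat mat" where
  "alt_pow M 0 = 1\<^sub>m (dim_row M)"
| "alt_pow M (Suc n) = alt_pow M n * (if even n then M else transpose_mat M)"

definition depth_ineq :: "nat mat \<Rightarrow> nat \<Rightarrow> bool" where
  "depth_ineq M n \<longleftrightarrow> (\<exists>q>0. alt_pow M (n + 1) \<le> q \<cdot>\<^sub>m alt_pow M (n - 1))"

definition has_depth :: "nat mat \<Rightarrow> nat \<Rightarrow> bool" where
  "has_depth M n \<longleftrightarrow> n \<ge> 2 \<and> depth_ineq M n \<and> (\<forall>k. 2 \<le> k \<and> k < n \<longrightarrow> \<not> depth_ineq M k)"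

definition vec_norm2 :: "real vec \<Rightarrow> real" where
  "vec_norm2 v = sqrt (v \<bullet> v)"

definition mat_op_norm :: "real mat \<Rightarrow> real" where
  "mat_op_norm M = (SUP v\<in>{v \<in> carrier_vec (dim_col M). vec_norm2 v \<le> 1}. vec_norm2 (M *\<^sub>v v))"

end

theory Submission
  imports Defs "HOL-Analysis.Convex"
begin

text \<open>
  Let \<open>p\<^sub>j\<close> be the minimal central projections of \<open>B\<close> and \<open>z\<^sub>i\<close> those of the ambient algebra.
  If \<open>L $$ (l, j)\<close> and \<open>L $$ (l, k)\<close> are nonzero, then \<open>p\<^sub>k x p\<^sub>j \<noteq> 0\<close> for some \<open>x\<close> in the
  \<open>l\<close>-th summand, so by regularity \<open>p\<^sub>k U p\<^sub>j \<noteq> 0\<close> for some normalizing unitary \<open>U\<close>.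
  Both \<open>U p\<^sub>j U\<^sup>*\<close> and \<open>U\<^sup>* p\<^sub>k U\<close> are central in \<open>B\<close>, so minimality of \<open>p\<^sub>k\<close> and \<open>p\<^sub>j\<close> makes \<open>p\<^sub>k\<close> a
  multiple of \<open>U p\<^sub>j U\<^sup>*\<close>. Multiplying by \<open>z\<^sub>i\<close> and taking traces, where the trace of \<open>z\<^sub>i p\<^sub>j\<close> is
  \<open>L $$ (i, j) * ms ! j\<close>, shows that \<open>L $$ (i, k) \<noteq> 0\<close> forces \<open>L $$ (i, j) \<noteq> 0\<close>. Hence the
  support of \<open>L L\<^sup>t L\<close> lies in that of \<open>L\<close>, which is depth 2.
  The norm bound is the Schur test for \<open>L\<close> with the column sums \<open>u\<close> of \<open>L\<close> as weights: summing
  \<open>L L\<^sup>t L \<le> q L\<close> over rows gives \<open>L\<^sup>t L u \<le> q u\<close>.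
\<close>

section \<open>Block-diagonal matrices\<close>

definition mat_trace :: "'a::comm_monoid_add mat \<Rightarrow> 'a" where
  "mat_trace X = (\<Sum>i<dim_row X. X $$ (i, i))"

lemma mat_trace_comm:
  fixes X Y :: "'a::comm_semiring_0 mat"
  assumes "X \<in> carrier_mat m n" "Y \<in> carrier_mat n m"
  shows "mat_trace (X * Y) = mat_trace (Y * X)"
proof -
  have "mat_trace (X * Y) = (\<Sum>i<m. \<Sum>k<n. X $$ (i, k) * Y $$ (k, i))"
    using assms by (auto simp: mat_trace_def scalar_prod_def lessThan_atLeast0 intro!: sum.cong)
  also have "\<dots> = (\<Sum>k<n. \<Sum>i<m. Y $$ (k, i) * X $$ (i, k))"
    by (subst sum.swap) (simp add: mult.commute)
  also have "\<dots> = mat_trace (Y * X)"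
    using assms by (auto simp: mat_trace_def scalar_prod_def lessThan_atLeast0 intro!: sum.cong)
  finally show ?thesis .
qed

lemma mat_trace_smult: "mat_trace (c \<cdot>\<^sub>m X) = c * mat_trace X"
  if "X \<in> carrier_mat n n" for X :: "'a::semiring_0 mat"
  using that by (auto simp: mat_trace_def sum_distrib_left intro!: sum.cong)

lemma mat_trace_one [simp]: "mat_trace (1\<^sub>m n :: 'a::semiring_1 mat) = of_nat n"
  by (simp add: mat_trace_def)

lemma mat_trace_zero [simp]: "mat_trace (0\<^sub>m n n) = 0"
  by (simp add: mat_trace_def)

lemma mat_trace_four_block:
  assumes "X \<in> carrier_mat m m" "Y \<in> carrier_mat n n"
  shows "mat_trace (four_block_mat X B C Y) = mat_trace X + mat_trace Y"
proof -
  have "mat_trace (four_block_mat X B C Y)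
      = (\<Sum>i<m + n. if i < m then X $$ (i, i) else Y $$ (i - m, i - m))"
    using carrier_matD[OF assms(1)] carrier_matD[OF assms(2)] unfolding mat_trace_def
    by (intro sum.cong) simp_all
  also have "\<dots> = (\<Sum>i<m. X $$ (i, i)) + (\<Sum>i<n. Y $$ (i, i))"
    by (induction n) (simp_all add: add.assoc)
  finally show ?thesis using assms by (simp add: mat_trace_def)
qed

lemma mat_trace_diag_block_mat:
  assumes "\<forall>b\<in>set bs. square_mat b"
  shows "mat_trace (diag_block_mat bs) = (\<Sum>b\<leftarrow>bs. mat_trace b)"
  using assms
proof (induction bs)
  case Nil
  then show ?case by (simp add: mat_trace_def)
next
  case (Cons b bs)
  have "square_mat (diag_block_mat bs)"
    using Cons.prems by (intro diag_block_mat_square) auto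
  then have D: "diag_block_mat bs \<in> carrier_mat (dim_row (diag_block_mat bs)) (dim_row (diag_block_mat bs))"
    by (intro carrier_matI) auto
  have b: "b \<in> carrier_mat (dim_row b) (dim_row b)"
    using Cons.prems by (intro carrier_matI) auto
  have "mat_trace (diag_block_mat bs) = (\<Sum>b\<leftarrow>bs. mat_trace b)"
    using Cons.prems by (intro Cons.IH) auto
  then show ?case
    unfolding diag_block_mat.simps Let_def mat_trace_four_block[OF b D] by simp
qed

section \<open>Arithmetic of block lists with prescribed sizes\<close>

lemma blocks_Nil [simp]: "blocks [] = {[]}"
  by (auto simp: blocks_def)

lemma blocks_Cons: "blocks (n # ns) = {b # bs |b bs. b \<in> carrier_mat n n \<and> bs \<in> blocks ns}"
proof -
  have "bs \<in> blocks (n # ns) \<longleftrightarrow> (\<exists>b bs'. bs = b # bs' \<and> b \<in> carrier_mat n n \<and> bs' \<in> blocks ns)" for bs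
    by (cases bs) (simp_all add: blocks_def All_less_Suc2 conj_ac)
  then show ?thesis by blast
qed

lemma blocks_length: "bs \<in> blocks ns \<Longrightarrow> length bs = length ns"
  by (simp add: blocks_def)

lemma blocks_nth: "bs \<in> blocks ns \<Longrightarrow> i < length ns \<Longrightarrow> bs ! i \<in> carrier_mat (ns ! i) (ns ! i)"
  by (simp add: blocks_def)

lemma diag_block_mat_carrier:
  "bs \<in> blocks ns \<Longrightarrow> diag_block_mat bs \<in> carrier_mat (sum_list ns) (sum_list ns)"
  by (induction ns arbitrary: bs) (auto simp: blocks_Cons Let_def)

lemma four_block_mat_inj:
  assumes "four_block_mat X B C Y = four_block_mat X' B' C' Y'"
    and "X \<in> carrier_mat m m'" "X' \<in> carrier_mat m m'" "Y \<in> carrier_mat n n'" "Y' \<in> carrier_mat n n'"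
  shows "X = X'" "Y = Y'"
proof -
  have entry: "four_block_mat X B C Y $$ (i, j) = four_block_mat X' B' C' Y' $$ (i, j)" for i j
    using assms(1) by simp
  show "X = X'"
  proof (rule eq_matI)
    fix i j assume "i < dim_row X'" "j < dim_col X'"
    then show "X $$ (i, j) = X' $$ (i, j)" using entry[of i j] assms(2-) by simp
  qed (use assms in auto)
  show "Y = Y'"
  proof (rule eq_matI)
    fix i j assume "i < dim_row Y'" "j < dim_col Y'"
    then show "Y $$ (i, j) = Y' $$ (i, j)" using entry[of "m + i" "m' + j"] assms(2-) by simp
  qed (use assms in auto)
qed

text \<open>Fixing the sizes \<open>ns\<close> makes the splitting of a matrix into diagonal blocks
  unique, so the first block and the remaining matrix can be read off by position. This lets
  equations in the big matrix algebra be compared block by block.\<close>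

lemma diag_block_mat_inj_on: "inj_on diag_block_mat (blocks ns)"
proof (induction ns)
  case (Cons n ns)
  show ?case
  proof (rule inj_onI)
    fix bs cs assume "bs \<in> blocks (n # ns)" "cs \<in> blocks (n # ns)"
      and eq: "diag_block_mat bs = diag_block_mat cs"
    then obtain b bs' c cs' where *: "bs = b # bs'" "cs = c # cs'" "b \<in> carrier_mat n n"
      "c \<in> carrier_mat n n" "bs' \<in> blocks ns" "cs' \<in> blocks ns"
      by (auto simp: blocks_Cons)
    note inj = four_block_mat_inj[OF eq[unfolded * diag_block_mat.simps Let_def] *(3,4)
        diag_block_mat_carrier[OF *(5)] diag_block_mat_carrier[OF *(6)]]
    have "bs' = cs'" using inj_onD[OF Cons inj(2)] * by simp
    with inj(1) * show "bs = cs" by simp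
  qed
qed auto

lemma diag_block_mat_mult:
  fixes bs cs :: "complex mat list"
  assumes "bs \<in> blocks ns" "cs \<in> blocks ns"
  shows "diag_block_mat bs * diag_block_mat cs = diag_block_mat (map2 (*) bs cs)"
  using assms
proof (induction ns arbitrary: bs cs)
  case (Cons n ns)
  then obtain b bs' c cs' where *: "bs = b # bs'" "cs = c # cs'" "b \<in> carrier_mat n n"
      "c \<in> carrier_mat n n" "bs' \<in> blocks ns" "cs' \<in> blocks ns"
    by (auto simp: blocks_Cons)
  let ?N = "sum_list ns"
  have D: "diag_block_mat bs' \<in> carrier_mat ?N ?N" "diag_block_mat cs' \<in> carrier_mat ?N ?N"
    using * diag_block_mat_carrier by auto
  have IH: "diag_block_mat (map2 (*) bs' cs') = diag_block_mat bs' * diag_block_mat cs'"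
    using Cons.IH[of bs' cs'] * by simp
  show ?case
    unfolding * diag_block_mat.simps Let_def zip_Cons_Cons list.map prod.case IH
    using * D by (subst mult_four_block_mat[where ?nr1.0 = n and ?n1.0 = n and ?n2.0 = ?N
      and ?nr2.0 = ?N and ?nc1.0 = n and ?nc2.0 = ?N]) auto
qed auto

lemma diag_block_mat_smult:
  fixes bs :: "complex mat list"
  assumes "bs \<in> blocks ns"
  shows "c \<cdot>\<^sub>m diag_block_mat bs = diag_block_mat (map ((\<cdot>\<^sub>m) c) bs)"
  using assms
proof (induction ns arbitrary: bs)
  case Nil
  then show ?case by auto
next
  case (Cons n ns)
  then obtain b bs' where *: "bs = b # bs'" "b \<in> carrier_mat n n" "bs' \<in> blocks ns"
    by (auto simp: blocks_Cons)
  have D: "diag_block_mat bs' \<in> carrier_mat (sum_list ns) (sum_list ns)"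
    using * diag_block_mat_carrier by auto
  have IH: "diag_block_mat (map ((\<cdot>\<^sub>m) c) bs') = c \<cdot>\<^sub>m diag_block_mat bs'"
    using Cons.IH[of bs'] * by simp
  show ?case
    unfolding * diag_block_mat.simps Let_def list.map IH
    using * D by (subst smult_four_block_mat) auto
qed

lemma blocks_map2_mult:
  fixes bs cs :: "complex mat list"
  assumes "bs \<in> blocks ns" "cs \<in> blocks ns"
  shows "map2 (*) bs cs \<in> blocks ns"
  using assms by (auto simp: blocks_def)

section \<open>Elements supported in one simple summand\<close>

definition single_block :: "nat list \<Rightarrow> nat \<Rightarrow> complex mat \<Rightarrow> complex mat list" where
  "single_block ns l X = map (\<lambda>k. if k = l then X else 0\<^sub>m (ns ! k) (ns ! k)) [0..<length ns]"

lemma single_block_in_blocks: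
  "X \<in> carrier_mat (ns ! l) (ns ! l) \<Longrightarrow> single_block ns l X \<in> blocks ns"
  by (auto simp: single_block_def blocks_def)

lemma single_block_nth:
  "k < length ns \<Longrightarrow> single_block ns l X ! k = (if k = l then X else 0\<^sub>m (ns ! k) (ns ! k))"
  by (simp add: single_block_def)

lemma length_single_block [simp]: "length (single_block ns l X) = length ns"
  by (simp add: single_block_def)

lemma single_block_mult_right:
  assumes "bs \<in> blocks ns" "l < length ns" "X \<in> carrier_mat (ns ! l) (ns ! l)"
  shows "diag_block_mat (single_block ns l X) * diag_block_mat bs
    = diag_block_mat (single_block ns l (X * bs ! l))"
proof -
  have "map2 (*) (single_block ns l X) bs = single_block ns l (X * bs ! l)"
  proof (rule nth_equalityI)
    fix k assume "k < length (map2 (*) (single_block ns l X) bs)"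
    then have "k < length ns" using assms by (simp add: blocks_length)
    then show "map2 (*) (single_block ns l X) bs ! k = single_block ns l (X * bs ! l) ! k"
      using assms blocks_nth[OF assms(1), of k] by (auto simp: single_block_nth blocks_length)
  qed (use assms in \<open>simp add: blocks_length\<close>)
  then show ?thesis
    using diag_block_mat_mult[OF single_block_in_blocks[OF assms(3)] assms(1)] by simp
qed

lemma single_block_mult_left:
  assumes "bs \<in> blocks ns" "l < length ns" "X \<in> carrier_mat (ns ! l) (ns ! l)"
  shows "diag_block_mat bs * diag_block_mat (single_block ns l X)
    = diag_block_mat (single_block ns l (bs ! l * X))"
proof -
  have "map2 (*) bs (single_block ns l X) = single_block ns l (bs ! l * X)"
  proof (rule nth_equalityI)
    fix k assume "k < length (map2 (*) bs (single_block ns l X))"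
    then have "k < length ns" using assms by (simp add: blocks_length)
    then show "map2 (*) bs (single_block ns l X) ! k = single_block ns l (bs ! l * X) ! k"
      using assms blocks_nth[OF assms(1), of k] by (auto simp: single_block_nth blocks_length)
  qed (use assms in \<open>simp add: blocks_length\<close>)
  then show ?thesis
    using diag_block_mat_mult[OF assms(1) single_block_in_blocks[OF assms(3)]] by simp
qed

lemma single_block_inject:
  assumes "diag_block_mat (single_block ns l X) = diag_block_mat (single_block ns l Y)"
    and "l < length ns" "X \<in> carrier_mat (ns ! l) (ns ! l)" "Y \<in> carrier_mat (ns ! l) (ns ! l)"
  shows "X = Y"
proof -
  have "single_block ns l X = single_block ns l Y"
    using assms by (intro inj_onD[OF diag_block_mat_inj_on[of ns]] single_block_in_blocks)
  then have "single_block ns l X ! l = single_block ns l Y ! l" by simp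
  with assms(2) show ?thesis by (simp add: single_block_nth)
qed

lemma single_block_smult:
  assumes "X \<in> carrier_mat (ns ! l) (ns ! l)"
  shows "diag_block_mat (single_block ns l (c \<cdot>\<^sub>m X)) = c \<cdot>\<^sub>m diag_block_mat (single_block ns l X)"
proof -
  have "map ((\<cdot>\<^sub>m) c) (single_block ns l X) = single_block ns l (c \<cdot>\<^sub>m X)"
    by (rule nth_equalityI) (auto simp: single_block_nth)
  then show ?thesis
    using diag_block_mat_smult[OF single_block_in_blocks[OF assms]] by metis
qed

lemma single_block_zero:
  "diag_block_mat (single_block ns l (0\<^sub>m (ns ! l) (ns ! l))) = 0\<^sub>m (sum_list ns) (sum_list ns)"
proof -
  let ?Z = "single_block ns l (0\<^sub>m (ns ! l) (ns ! l))"
  \<comment> \<open>The zero block is 0 times itself, so pulling the scalar 0 out of the block makes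
    the whole matrix vanish.\<close>
  have "?Z \<in> blocks ns" by (rule single_block_in_blocks) simp
  from diag_block_mat_carrier[OF this] have "0 \<cdot>\<^sub>m diag_block_mat ?Z = 0\<^sub>m (sum_list ns) (sum_list ns)"
    by auto
  then show ?thesis
    using single_block_smult[of "0\<^sub>m (ns ! l) (ns ! l)" ns l 0] by simp
qed

lemma mat_trace_single_block:
  assumes "l < length ns" "X \<in> carrier_mat (ns ! l) (ns ! l)"
  shows "mat_trace (diag_block_mat (single_block ns l X)) = mat_trace X"
proof -
  have "\<forall>b\<in>set (single_block ns l X). square_mat b"
    using assms by (auto simp: single_block_def)
  then have "mat_trace (diag_block_mat (single_block ns l X)) = (\<Sum>b\<leftarrow>single_block ns l X. mat_trace b)"
    by (rule mat_trace_diag_block_mat)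
  also have "\<dots> = (\<Sum>k<length ns. if k = l then mat_trace X else 0)"
    by (auto simp del: sum.delta sum.delta' simp: sum_list_sum_nth single_block_nth lessThan_atLeast0
      intro!: sum.cong)
  finally show ?thesis using assms by simp
qed

section \<open>Full matrix algebras\<close>

definition matrix_unit :: "nat \<Rightarrow> nat \<Rightarrow> nat \<Rightarrow> 'a::zero_neq_one mat" where
  "matrix_unit n a b = mat n n (\<lambda>(i, j). if i = a \<and> j = b then 1 else 0)"

lemma matrix_unit_carrier [simp]: "matrix_unit n a b \<in> carrier_mat n n"
  by (simp add: matrix_unit_def)

lemma mult_matrix_unit:
  fixes X :: "'a::semiring_1 mat"
  assumes "X \<in> carrier_mat n n" "a < n" "b < n" "i < n" "j < n"
  shows "(X * matrix_unit n a b) $$ (i, j) = (if j = b then X $$ (i, a) else 0)"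
proof -
  have "(X * matrix_unit n a b) $$ (i, j) = (\<Sum>k<n. X $$ (i, k) * (if k = a \<and> j = b then 1 else 0))"
    using assms by (auto simp: matrix_unit_def scalar_prod_def lessThan_atLeast0 intro!: sum.cong)
  also have "\<dots> = (\<Sum>k<n. if k = a then (if j = b then X $$ (i, k) else 0) else 0)"
    by (rule sum.cong) auto
  finally show ?thesis using assms by simp
qed

lemma matrix_unit_mult:
  fixes X :: "'a::semiring_1 mat"
  assumes "X \<in> carrier_mat n n" "a < n" "b < n" "i < n" "j < n"
  shows "(matrix_unit n a b * X) $$ (i, j) = (if i = a then X $$ (b, j) else 0)"
proof -
  have "(matrix_unit n a b * X) $$ (i, j) = (\<Sum>k<n. (if i = a \<and> k = b then 1 else 0) * X $$ (k, j))"
    using assms by (auto simp: matrix_unit_def scalar_prod_def lessThan_atLeast0 intro!: sum.cong)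
  also have "\<dots> = (\<Sum>k<n. if k = b then (if i = a then X $$ (k, j) else 0) else 0)"
    by (rule sum.cong) auto
  finally show ?thesis using assms by simp
qed

text \<open>Commuting with the matrix unit at position (j, 0) suffices: in entry (i, 0) one product
  shows \<open>X $$ (i, j)\<close>, the other \<open>X $$ (0, 0)\<close> if i = j and 0
  otherwise.\<close>

lemma central_mat_is_scalar:
  fixes X :: "'a::semiring_1 mat"
  assumes X: "X \<in> carrier_mat n n" and central: "\<And>Y. Y \<in> carrier_mat n n \<Longrightarrow> X * Y = Y * X"
  shows "\<exists>c. X = c \<cdot>\<^sub>m 1\<^sub>m n"
proof -
  have eq: "(X * matrix_unit n a b) $$ (i, j) = (matrix_unit n a b * X) $$ (i, j)" for a b i j
    using central[of "matrix_unit n a b"] by simp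
  \<comment> \<open>For n = 0 this entry is an unspecified value, but then there are no entries to
    compare.\<close>
  define c where "c = X $$ (0, 0)"
  have "X $$ (i, j) = (if i = j then c else 0)" if ij: "i < n" "j < n" for i j
  proof -
    have n: "0 < n" using ij by simp
    show ?thesis
      unfolding c_def
      using eq[of j 0 i 0] mult_matrix_unit[OF X ij(2) n ij(1) n] matrix_unit_mult[OF X ij(2) n ij(1) n]
      by presburger
  qed
  then have "X = c \<cdot>\<^sub>m 1\<^sub>m n"
    using X by (intro eq_matI) auto
  then show ?thesis ..
qed

text \<open>A matrix unit can link any column of \<open>P\<close> to any row of \<open>Q\<close>.
  Linking a nonzero entry (c, a) of \<open>P\<close> with a nonzero entry (b, d) of \<open>Q\<close>
  leaves their product in position (c, d), and it is nonzero as there are no zero divisors.\<close>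

lemma full_mat_algebra_prime:
  fixes P Q :: "'a::idom mat"
  assumes P: "P \<in> carrier_mat n n" "P \<noteq> 0\<^sub>m n n" and Q: "Q \<in> carrier_mat n n" "Q \<noteq> 0\<^sub>m n n"
  shows "\<exists>X\<in>carrier_mat n n. P * X * Q \<noteq> 0\<^sub>m n n"
proof -
  have nonzero: "\<exists>i<n. \<exists>j<n. Y $$ (i, j) \<noteq> 0" if "Y \<in> carrier_mat n n" "Y \<noteq> 0\<^sub>m n n" for Y :: "'a mat"
  proof (rule ccontr)
    assume "\<not> ?thesis"
    then have "Y = 0\<^sub>m n n" using that(1) by (intro eq_matI) auto
    with that(2) show False by simp
  qed
  obtain c a where ca: "c < n" "a < n" "P $$ (c, a) \<noteq> 0"
    using nonzero[OF P] by blast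
  obtain b d where bd: "b < n" "d < n" "Q $$ (b, d) \<noteq> 0"
    using nonzero[OF Q] by blast
  have "(P * matrix_unit n a b * Q) $$ (c, d) = (\<Sum>k<n. (P * matrix_unit n a b) $$ (c, k) * Q $$ (k, d))"
    using P Q ca bd by (auto simp: scalar_prod_def lessThan_atLeast0 matrix_unit_def intro!: sum.cong)
  also have "\<dots> = (\<Sum>k<n. if k = b then P $$ (c, a) * Q $$ (k, d) else 0)"
    using P ca bd by (intro sum.cong) (auto simp: mult_matrix_unit)
  also have "\<dots> = P $$ (c, a) * Q $$ (b, d)" using bd by simp
  finally have "P * matrix_unit n a b * Q \<noteq> 0\<^sub>m n n" using ca bd by auto
  then show ?thesis by (intro bexI[of _ "matrix_unit n a b"]) auto
qed

section \<open>Central elements and the trace of the inclusion\<close>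

lemma single_block_one_central:
  assumes "bs \<in> blocks ms" "k < length ms"
  shows "diag_block_mat (single_block ms k (1\<^sub>m (ms ! k))) * diag_block_mat bs
    = diag_block_mat bs * diag_block_mat (single_block ms k (1\<^sub>m (ms ! k)))"
  using blocks_nth[OF assms] by (simp add: single_block_mult_right[OF assms] single_block_mult_left[OF assms])

text \<open>Minimality of the k-th central projection: the k-th block of a central element commutes
  with every matrix of its size, hence is scalar, and multiplying by the projection keeps only this
  block.\<close>

lemma single_block_one_minimal:
  assumes bs: "bs \<in> blocks ms" and k: "k < length ms"
    and central: "\<And>cs. cs \<in> blocks ms \<Longrightarrow>
      diag_block_mat bs * diag_block_mat cs = diag_block_mat cs * diag_block_mat bs"
  shows "\<exists>c. diag_block_mat (single_block ms k (1\<^sub>m (ms ! k))) * diag_block_mat bs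
    = c \<cdot>\<^sub>m diag_block_mat (single_block ms k (1\<^sub>m (ms ! k)))"
proof -
  have bk: "bs ! k \<in> carrier_mat (ms ! k) (ms ! k)" by (rule blocks_nth[OF bs k])
  have "bs ! k * Y = Y * bs ! k" if Y: "Y \<in> carrier_mat (ms ! k) (ms ! k)" for Y
  proof (rule single_block_inject)
    show "diag_block_mat (single_block ms k (bs ! k * Y)) = diag_block_mat (single_block ms k (Y * bs ! k))"
      using central[OF single_block_in_blocks[OF Y]]
      by (simp add: single_block_mult_left[OF bs k Y] single_block_mult_right[OF bs k Y])
  qed (use k bk Y in auto)
  then obtain c where c: "bs ! k = c \<cdot>\<^sub>m 1\<^sub>m (ms ! k)"
    using central_mat_is_scalar[OF bk] by blast
  have "1\<^sub>m (ms ! k) * bs ! k = c \<cdot>\<^sub>m 1\<^sub>m (ms ! k)"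
    using bk by (simp add: c)
  then show ?thesis
    using single_block_mult_right[OF bs k, of "1\<^sub>m (ms ! k)"]
      single_block_smult[of "1\<^sub>m (ms ! k)" ms k c] by (intro exI[of _ c]) simp
qed

text \<open>Transport of the two preceding lemmas along \<open>\<phi>\<close>. The three conclusions
  are what the argument with normalizing unitaries needs to know about the minimal central
  projections of \<open>B\<close>.\<close>

lemma star_isomorphism_minimal_central:
  assumes iso: "star_isomorphism \<phi> (multi_matrix_algebra ms) B" and k: "k < length ms"
  defines "p \<equiv> \<phi> (diag_block_mat (single_block ms k (1\<^sub>m (ms ! k))))"
  shows "p \<in> B"
    and "\<And>b. b \<in> B \<Longrightarrow> p * b = b * p"
    and "\<And>c. c \<in> B \<Longrightarrow> (\<And>b. b \<in> B \<Longrightarrow> c * b = b * c) \<Longrightarrow> \<exists>\<alpha>. p * c = \<alpha> \<cdot>\<^sub>m p"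
proof -
  let ?M = "multi_matrix_algebra ms" and ?e = "diag_block_mat (single_block ms k (1\<^sub>m (ms ! k)))"
  have e: "?e \<in> ?M"
    unfolding multi_matrix_algebra_def by (intro imageI single_block_in_blocks) simp
  have img: "\<phi> ` ?M = B" and inj: "inj_on \<phi> ?M"
    using iso by (auto simp: star_isomorphism_def bij_betw_def)
  have mult: "\<phi> (x * y) = \<phi> x * \<phi> y" if "x \<in> ?M" "y \<in> ?M" for x y
    using iso that by (auto simp: star_isomorphism_def)
  have smult: "\<phi> (a \<cdot>\<^sub>m x) = a \<cdot>\<^sub>m \<phi> x" if "x \<in> ?M" for a x
    using iso that by (auto simp: star_isomorphism_def)
  have closed: "x * y \<in> ?M" if xy: "x \<in> ?M" "y \<in> ?M" for x y
  proof -
    obtain bs cs where *: "bs \<in> blocks ms" "cs \<in> blocks ms" "x = diag_block_mat bs" "y = diag_block_mat cs"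
      using xy unfolding multi_matrix_algebra_def by blast
    show ?thesis
      unfolding *(3,4) diag_block_mat_mult[OF *(1,2)] multi_matrix_algebra_def
      by (intro imageI blocks_map2_mult *)
  qed
  show "p \<in> B" using e img by (auto simp: p_def)
  show "p * b = b * p" if b: "b \<in> B" for b
  proof -
    obtain bs where bs: "bs \<in> blocks ms" "b = \<phi> (diag_block_mat bs)"
      using b unfolding img[symmetric] multi_matrix_algebra_def by blast
    have x: "diag_block_mat bs \<in> ?M" using bs(1) unfolding multi_matrix_algebra_def by blast
    show ?thesis
      unfolding p_def bs(2) mult[OF e x, symmetric] mult[OF x e, symmetric]
        single_block_one_central[OF bs(1) k] ..
  qed
  show "\<exists>\<alpha>. p * c = \<alpha> \<cdot>\<^sub>m p" if c: "c \<in> B" and central: "\<And>b. b \<in> B \<Longrightarrow> c * b = b * c" for c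
  proof -
    obtain bs where bs: "bs \<in> blocks ms" "c = \<phi> (diag_block_mat bs)"
      using c unfolding img[symmetric] multi_matrix_algebra_def by blast
    have x: "diag_block_mat bs \<in> ?M" using bs(1) unfolding multi_matrix_algebra_def by blast
    \<comment> \<open>Centrality is pulled back from \<open>B\<close>: both products lie in the
      domain of \<open>\<phi>\<close> and have the same image, so injectivity identifies
      them.\<close>
    have "diag_block_mat bs * diag_block_mat cs = diag_block_mat cs * diag_block_mat bs"
      if "cs \<in> blocks ms" for cs
    proof (rule inj_onD[OF inj])
      have y: "diag_block_mat cs \<in> ?M" using that unfolding multi_matrix_algebra_def by blast
      then have "\<phi> (diag_block_mat cs) \<in> B" using img by blast
      from central[OF this] show "\<phi> (diag_block_mat bs * diag_block_mat cs)
          = \<phi> (diag_block_mat cs * diag_block_mat bs)"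
        unfolding bs(2) mult[OF x y] mult[OF y x] .
      show "diag_block_mat bs * diag_block_mat cs \<in> ?M" "diag_block_mat cs * diag_block_mat bs \<in> ?M"
        by (intro closed x y)+
    qed
    then obtain \<alpha> where "?e * diag_block_mat bs = \<alpha> \<cdot>\<^sub>m ?e"
      using single_block_one_minimal[OF bs(1) k] by blast
    then show ?thesis
      unfolding p_def bs(2) using mult[OF e x] smult[OF e] by metis
  qed
qed

section \<open>Size and trace of a direct sum of copies\<close>

lemma sum_list_concat_replicate:
  fixes g :: "'b \<Rightarrow> 'a::semiring_1"
  shows "(\<Sum>x\<leftarrow>concat (map (\<lambda>j. replicate (a j) (h j)) [0..<n]). g x) = (\<Sum>j<n. of_nat (a j) * g (h j))"
  by (induction n) (simp_all add: sum_list_replicate)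

lemma direct_sum_copies_carrier:
  assumes "bs \<in> blocks ms" "(\<Sum>j<length ms. a j * ms ! j) = n"
  shows "direct_sum_copies a bs \<in> carrier_mat n n"
proof -
  have len: "length bs = length ms" by (rule blocks_length[OF assms(1)])
  have dims: "dim_row (bs ! j) = ms ! j" "dim_col (bs ! j) = ms ! j" if "j < length ms" for j
    using blocks_nth[OF assms(1) that] by auto
  have "dim_row (direct_sum_copies a bs) = n" "dim_col (direct_sum_copies a bs) = n"
    unfolding direct_sum_copies_def dim_diag_block_mat sum_list_concat_replicate
    using dims by (simp_all add: len assms(2)[symmetric])
  then show ?thesis by (rule carrier_matI)
qed

text \<open>This is how multiplicities become visible: at the unit of the j-th summand the
  right-hand side collapses to \<open>a j\<close> times the size of that summand.\<close>

lemma mat_trace_direct_sum_copies: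
  fixes bs :: "complex mat list"
  assumes "bs \<in> blocks ms"
  shows "mat_trace (direct_sum_copies a bs) = (\<Sum>j<length ms. of_nat (a j) * mat_trace (bs ! j))"
proof -
  have "square_mat b" if b: "b \<in> set (concat (map (\<lambda>j. replicate (a j) (bs ! j)) [0..<length bs]))" for b
  proof -
    obtain j where "j < length bs" "b = bs ! j" using b by auto
    with blocks_nth[OF assms, of j] blocks_length[OF assms] show ?thesis by auto
  qed
  then show ?thesis
    unfolding direct_sum_copies_def
    by (simp add: mat_trace_diag_block_mat sum_list_concat_replicate blocks_length[OF assms] del: square_mat.simps)
qed

lemma mat_adjoint_carrier:
  fixes U :: "complex mat"
  shows "U \<in> carrier_mat n n \<Longrightarrow> mat_adjoint U \<in> carrier_mat n n"
  by (auto simp: mat_adjoint_def)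

section \<open>Normalizing unitaries\<close>

text \<open>Here \<open>V\<close> stands for the adjoint of \<open>U\<close>. The element
  \<open>p * U * q\<close> is evaluated twice: minimality of \<open>p\<close> against the central
  element \<open>U * q * V\<close> gives \<alpha> times \<open>p * U\<close>, and minimality of
  \<open>q\<close> against the central element \<open>V * p * U\<close> gives \<beta> times
  \<open>U * q\<close>. Equating the two and multiplying by \<open>V\<close> on the right proves the
  claim.\<close>

lemma normalizer_intertwines_minimal_central:
  fixes B :: "complex mat set"
  assumes B: "B \<subseteq> carrier_mat N N" and U: "U \<in> carrier_mat N N" and V: "V \<in> carrier_mat N N"
    and UV: "U * V = 1\<^sub>m N" and VU: "V * U = 1\<^sub>m N" and conj: "(\<lambda>b. U * b * V) ` B = B"
    and pB: "p \<in> B" and qB: "q \<in> B"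
    and p_central: "\<And>b. b \<in> B \<Longrightarrow> p * b = b * p" and q_central: "\<And>b. b \<in> B \<Longrightarrow> q * b = b * q"
    and p_minimal: "\<And>c. c \<in> B \<Longrightarrow> (\<And>b. b \<in> B \<Longrightarrow> c * b = b * c) \<Longrightarrow> \<exists>\<alpha>. p * c = \<alpha> \<cdot>\<^sub>m p"
    and q_minimal: "\<And>c. c \<in> B \<Longrightarrow> (\<And>b. b \<in> B \<Longrightarrow> c * b = b * c) \<Longrightarrow> \<exists>\<alpha>. q * c = \<alpha> \<cdot>\<^sub>m q"
    and nonzero: "p * U * q \<noteq> 0\<^sub>m N N"
  shows "\<exists>\<alpha> \<beta>. \<alpha> \<noteq> 0 \<and> \<alpha> \<cdot>\<^sub>m p = \<beta> \<cdot>\<^sub>m (U * q * V)"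
proof -
  let ?C = "carrier_mat N N :: complex mat set"
  have closed: "X * Y \<in> ?C" if "X \<in> ?C" "Y \<in> ?C" for X Y using that by (rule mult_carrier_mat)
  have assoc: "X * Y * Z = X * (Y * Z)" if "X \<in> ?C" "Y \<in> ?C" "Z \<in> ?C" for X Y Z
    using that by (rule assoc_mult_mat)
  have scal: "(a \<cdot>\<^sub>m X) * Y = a \<cdot>\<^sub>m (X * Y)" "X * (a \<cdot>\<^sub>m Y) = a \<cdot>\<^sub>m (X * Y)" if "X \<in> ?C" "Y \<in> ?C" for X Y a
    using that by (auto intro: mult_smult_distrib)
  have cancel: "U * (V * X) = X" "V * (U * X) = X" if "X \<in> ?C" for X
    using assoc[OF U V that] assoc[OF V U that] that by (simp_all add: UV VU)
  have BC: "b \<in> ?C" if "b \<in> B" for b using B that by blast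
  have p: "p \<in> ?C" and q: "q \<in> ?C" using BC pB qB by auto
  note simps = assoc closed U V p q UV VU cancel right_mult_one_mat[of _ N N] left_mult_one_mat[of _ N N]

  have "U * q * V \<in> B" using conj qB by blast
  moreover have "U * q * V * y = y * (U * q * V)" if y: "y \<in> B" for y
  proof -
    obtain b where b: "b \<in> B" "y = U * b * V" using conj y by blast
    note bC = BC[OF b(1)]
    have "U * q * V * y = U * (q * b) * V" unfolding b(2) by (simp add: simps bC)
    also have "\<dots> = U * (b * q) * V" using q_central[OF b(1)] by simp
    also have "\<dots> = y * (U * q * V)" unfolding b(2) by (simp add: simps bC)
    finally show ?thesis .
  qed
  ultimately obtain \<alpha> where "p * (U * q * V) = \<alpha> \<cdot>\<^sub>m p" using p_minimal by blast
  moreover have "p * U * q = p * (U * q * V) * U" by (simp add: simps)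
  ultimately have \<alpha>: "p * U * q = \<alpha> \<cdot>\<^sub>m (p * U)" by (simp add: scal p U)
  have "\<alpha> \<noteq> 0"
  proof
    assume "\<alpha> = 0"
    then have "p * U * q = 0\<^sub>m N N"
      unfolding \<alpha> using p U by (intro eq_matI) auto
    with nonzero show False ..
  qed

  \<comment> \<open>Since conjugation by \<open>U\<close> maps onto \<open>B\<close>, the element
    \<open>b\<close>, which equals \<open>V * p * U\<close>, lies in \<open>B\<close>.\<close>
  obtain b where b: "b \<in> B" "p = U * b * V" using conj pB by blast
  note bC = BC[OF b(1)]
  have pU: "p * U = U * b" unfolding b(2) by (simp add: assoc closed U V bC VU right_mult_one_mat[OF bC])
  \<comment> \<open>Centrality of \<open>p\<close> is applied to the conjugate
    \<open>U * y * V\<close>; then the outer \<open>U\<close> and \<open>V\<close> are stripped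
    off.\<close>
  have "b * y = y * b" if "y \<in> B" for y
  proof -
    note yC = BC[OF that]
    have "U * y * V \<in> B" using conj that by blast
    from p_central[OF this] have "U * (b * (y * V)) = U * (y * (b * V))"
      unfolding b(2) by (simp add: simps bC yC)
    then have "V * (U * (b * (y * V))) * U = V * (U * (y * (b * V))) * U" by simp
    then show ?thesis by (simp add: simps bC yC)
  qed
  then obtain \<beta> where \<beta>: "q * b = \<beta> \<cdot>\<^sub>m q" using q_minimal[OF b(1)] by blast
  have "p * U * q = U * (q * b)" unfolding pU q_central[OF b(1)] by (simp add: assoc U bC q)
  then have "\<alpha> \<cdot>\<^sub>m (p * U) = \<beta> \<cdot>\<^sub>m (U * q)" unfolding \<alpha> \<beta> by (simp add: scal U q)
  then have "\<alpha> \<cdot>\<^sub>m (p * U) * V = \<beta> \<cdot>\<^sub>m (U * q) * V" by simp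
  then have "\<alpha> \<cdot>\<^sub>m p = \<beta> \<cdot>\<^sub>m (U * q * V)" by (simp add: scal simps)
  with \<open>\<alpha> \<noteq> 0\<close> show ?thesis by blast
qed

text \<open>The matrices x with p x q = 0 form a subspace. In contrapositive form this turns a
  nonzero product for some x in the span into a nonzero product for a member of
  \<open>S\<close>.\<close>

lemma span_vanishing_product:
  fixes p q x :: "complex mat"
  assumes S: "S \<subseteq> carrier_mat N N" and p: "p \<in> carrier_mat N N" and q: "q \<in> carrier_mat N N"
    and zero: "\<And>U. U \<in> S \<Longrightarrow> p * U * q = 0\<^sub>m N N"
    and x: "x \<in> LinearCombinations.module.span class_ring (module_mat TYPE(complex) N N) S"
  shows "p * x * q = 0\<^sub>m N N"
proof -
  interpret V: vectorspace "class_ring :: complex ring" "module_mat TYPE(complex) N N"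
    by (rule matrix_vs)
  let ?K = "{x \<in> carrier_mat N N. p * x * q = 0\<^sub>m N N}"
  have "submodule class_ring ?K (module_mat TYPE(complex) N N)"
  proof (unfold_locales, unfold matrix_vs_simps)
    show "?K \<subseteq> carrier_mat N N" by blast
    show "0\<^sub>m N N \<in> ?K" using p q by simp
    show "v + w \<in> ?K" if "v \<in> ?K" "w \<in> ?K" for v w
      using that p q by (simp add: mult_add_distrib_mat[of _ N N _ N] add_mult_distrib_mat[of _ N N _ _ N])
    show "c \<cdot>\<^sub>m v \<in> ?K" if "v \<in> ?K" for c v
      using that p q by (simp add: mult_smult_distrib[of _ N N _ N] mult_smult_assoc_mat[of _ N N _ N])
  qed
  moreover have "S \<subseteq> ?K" using S zero by blast
  ultimately have "V.span S \<subseteq> ?K" by (intro V.span_is_subset)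
  with x show ?thesis by blast
qed

text \<open>In terms of \<open>L\<close>: if rows i and l share a nonzero column k, the support of
  row l lies in that of row i. By symmetry, any two rows have equal or disjoint supports.\<close>

lemma regular_inclusion_support:
  fixes L :: "nat mat"
  assumes pos: "\<forall>m\<in>set ms. m > 0"
    and sub: "unital_star_subalgebra (sum_list ns) B (multi_matrix_algebra ns)"
    and incl: "is_inclusion_matrix ns ms B L"
    and reg: "regular_inclusion (sum_list ns) (multi_matrix_algebra ns) B"
    and i: "i < length ns" and l: "l < length ns" and j: "j < length ms" and k: "k < length ms"
    and nz: "L $$ (l, j) \<noteq> 0" "L $$ (l, k) \<noteq> 0" "L $$ (i, k) \<noteq> 0"
  shows "L $$ (i, j) \<noteq> 0"
proof -
  let ?A = "multi_matrix_algebra ns" and ?N = "sum_list ns"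
  obtain \<phi> W where iso: "star_isomorphism \<phi> (multi_matrix_algebra ms) B"
    and W: "\<And>i. i < length ns \<Longrightarrow> unitary_mat (ns ! i) (W i)"
    and \<phi>: "\<And>bs. bs \<in> blocks ms \<Longrightarrow> \<phi> (diag_block_mat bs) =
           diag_block_mat (map (\<lambda>i. W i * direct_sum_copies (\<lambda>j. L $$ (i, j)) bs * mat_adjoint (W i))
             [0..<length ns])"
    and rows: "\<And>i. i < length ns \<Longrightarrow> (\<Sum>j<length ms. L $$ (i, j) * ms ! j) = ns ! i"
    using incl unfolding is_inclusion_matrix_def by blast
  define e where "e = (\<lambda>j. single_block ms j (1\<^sub>m (ms ! j)))"
  \<comment> \<open>\<open>P j ! i\<close> is the component of the j-th minimal central projection
    of \<open>B\<close> in the i-th summand of the ambient algebra.\<close>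
  define P where "P = (\<lambda>j. map (\<lambda>i. W i * direct_sum_copies (\<lambda>j. L $$ (i, j)) (e j) * mat_adjoint (W i))
             [0..<length ns])"
  define p where "p = (\<lambda>j. \<phi> (diag_block_mat (e j)))"
  have e: "e j \<in> blocks ms" for j unfolding e_def by (rule single_block_in_blocks) simp
  have D: "direct_sum_copies (\<lambda>j. L $$ (i, j)) (e j) \<in> carrier_mat (ns ! i) (ns ! i)" if "i < length ns" for i j
    by (rule direct_sum_copies_carrier[OF e rows[OF that]])
  have Wc: "W i \<in> carrier_mat (ns ! i) (ns ! i)" "mat_adjoint (W i) \<in> carrier_mat (ns ! i) (ns ! i)"
    "mat_adjoint (W i) * W i = 1\<^sub>m (ns ! i)" if "i < length ns" for i
    using W[OF that] by (auto simp: unitary_mat_def intro: mat_adjoint_carrier)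
  have P: "P j \<in> blocks ns" for j
    unfolding blocks_def P_def using D Wc by (auto intro!: mult_carrier_mat)
  have p_P: "p j = diag_block_mat (P j)" for j unfolding p_def P_def by (rule \<phi>[OF e])
  have trP: "mat_trace (P j ! i) = of_nat (L $$ (i, j) * ms ! j)" if i: "i < length ns" and j: "j < length ms" for i j
  proof -
    let ?D = "direct_sum_copies (\<lambda>j. L $$ (i, j)) (e j)"
    note D = D[OF i, of j] and Wc = Wc[OF i]
    have "mat_trace (P j ! i) = mat_trace (W i * ?D * mat_adjoint (W i))"
      unfolding P_def using i by simp
    also have "\<dots> = mat_trace (mat_adjoint (W i) * (W i * ?D))"
      by (rule mat_trace_comm[OF mult_carrier_mat[OF Wc(1) D] Wc(2)])
    also have "\<dots> = mat_trace ?D"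
      using assoc_mult_mat[OF Wc(2,1) D] left_mult_one_mat[OF D] Wc(3) by metis
    also have "\<dots> = (\<Sum>k<length ms. if k = j then of_nat (L $$ (i, j) * ms ! j) else 0)"
      unfolding mat_trace_direct_sum_copies[OF e]
      by (intro sum.cong) (auto simp: e_def single_block_nth)
    finally show ?thesis using j by simp
  qed
  have ms_pos: "ms ! j > 0" if "j < length ms" for j using pos that by auto
  \<comment> \<open>The trace detects nonvanishing because the summand sizes in \<open>ms\<close>
    are positive.\<close>
  have P_nz: "P j ! i \<noteq> 0\<^sub>m (ns ! i) (ns ! i)" if "i < length ns" "j < length ms" "L $$ (i, j) \<noteq> 0" for i j
  proof
    assume "P j ! i = 0\<^sub>m (ns ! i) (ns ! i)"
    then have "of_nat (L $$ (i, j) * ms ! j) = (0 :: complex)" using trP[OF that(1,2)] by simp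
    then show False using that(3) ms_pos[OF that(2)] by simp
  qed
  have Pc: "P j ! i \<in> carrier_mat (ns ! i) (ns ! i)" if "i < length ns" for i j
    by (rule blocks_nth[OF P that])
  \<comment> \<open>Columns j and k are both nonzero in row l, so primeness of the l-th full matrix
    algebra applies to the two components there.\<close>
  obtain X where X: "X \<in> carrier_mat (ns ! l) (ns ! l)" and
    PXQ: "P k ! l * X * P j ! l \<noteq> 0\<^sub>m (ns ! l) (ns ! l)"
    using full_mat_algebra_prime[OF Pc P_nz Pc P_nz] l j k nz by metis
  let ?x = "diag_block_mat (single_block ns l X)"
  have px: "p k * ?x * p j = diag_block_mat (single_block ns l (P k ! l * X * P j ! l))"
    unfolding p_P using X Pc[OF l, of k]
    by (simp add: single_block_mult_left[OF P l] single_block_mult_right[OF P l])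
  have px_nz: "p k * ?x * p j \<noteq> 0\<^sub>m ?N ?N"
  proof
    assume "p k * ?x * p j = 0\<^sub>m ?N ?N"
    then have "diag_block_mat (single_block ns l (P k ! l * X * P j ! l))
        = diag_block_mat (single_block ns l (0\<^sub>m (ns ! l) (ns ! l)))"
      unfolding px single_block_zero .
    then have "P k ! l * X * P j ! l = 0\<^sub>m (ns ! l) (ns ! l)"
      by (rule single_block_inject) (use l X Pc[OF l] in \<open>auto intro!: mult_carrier_mat\<close>)
    with PXQ show False ..
  qed
  have B: "B \<subseteq> carrier_mat ?N ?N" and A: "?A \<subseteq> carrier_mat ?N ?N"
    using sub unfolding unital_star_subalgebra_def by auto
  have pB: "p j \<in> B" if "j < length ms" for j
    unfolding p_def e_def by (rule star_isomorphism_minimal_central[OF iso that])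
  have p_central: "\<And>b. b \<in> B \<Longrightarrow> p j * b = b * p j" if "j < length ms" for j
    unfolding p_def e_def by (rule star_isomorphism_minimal_central[OF iso that])
  have p_minimal: "\<And>c. c \<in> B \<Longrightarrow> (\<And>b. b \<in> B \<Longrightarrow> c * b = b * c) \<Longrightarrow> \<exists>\<alpha>. p j * c = \<alpha> \<cdot>\<^sub>m p j"
    if "j < length ms" for j
    unfolding p_def e_def by (rule star_isomorphism_minimal_central[OF iso that])
  have pC: "p j \<in> carrier_mat ?N ?N" if "j < length ms" for j using pB[OF that] B by blast
  have NC: "normalizer ?N ?A B \<subseteq> carrier_mat ?N ?N" using A by (auto simp: normalizer_def)
  have "?x \<in> ?A" unfolding multi_matrix_algebra_def by (intro imageI single_block_in_blocks X)
  then have "?x \<in> LinearCombinations.module.span class_ring (module_mat TYPE(complex) ?N ?N) (normalizer ?N ?A B)"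
    using reg by (simp add: regular_inclusion_def)
  \<comment> \<open>Regularity enters here: \<open>?x\<close> is in the span of the normalizer, so
    some normalizing unitary is not annihilated either.\<close>
  then obtain U where U: "U \<in> normalizer ?N ?A B" and pUp: "p k * U * p j \<noteq> 0\<^sub>m ?N ?N"
    using span_vanishing_product[OF NC pC[OF k] pC[OF j]] px_nz by blast
  define V where "V = mat_adjoint U"
  have UC: "U \<in> carrier_mat ?N ?N" using U NC by blast
  have VC: "V \<in> carrier_mat ?N ?N" unfolding V_def by (rule mat_adjoint_carrier[OF UC])
  have UV: "U * V = 1\<^sub>m ?N" "V * U = 1\<^sub>m ?N" "(\<lambda>b. U * b * V) ` B = B"
    using U by (auto simp: normalizer_def unitary_mat_def V_def)
  obtain \<alpha> \<beta> where \<alpha>: "\<alpha> \<noteq> 0" and eq: "\<alpha> \<cdot>\<^sub>m p k = \<beta> \<cdot>\<^sub>m (U * p j * V)"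
    using normalizer_intertwines_minimal_central[OF B UC VC UV pB[OF k] pB[OF j] p_central[OF k] p_central[OF j]
        p_minimal[OF k] p_minimal[OF j] pUp] by blast
  \<comment> \<open>Multiplying by the unit \<open>z\<close> of the i-th summand restricts the trace
    to row i. As \<open>U\<close> lies in the ambient algebra, \<open>z\<close> commutes with it, so
    conjugation by \<open>U\<close> leaves this restricted trace unchanged.\<close>
  define z where "z = diag_block_mat (single_block ns i (1\<^sub>m (ns ! i)))"
  have zC: "z \<in> carrier_mat ?N ?N"
    unfolding z_def by (intro diag_block_mat_carrier single_block_in_blocks) simp
  have tr_zp: "mat_trace (z * p j) = of_nat (L $$ (i, j) * ms ! j)" if "j < length ms" for j
  proof -
    have "z * p j = diag_block_mat (single_block ns i (P j ! i))"
      unfolding z_def p_P using Pc[OF i, of j] by (simp add: single_block_mult_right[OF P i])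
    then show ?thesis
      using mat_trace_single_block[OF i Pc[OF i, of j]] trP[OF i that] by simp
  qed
  obtain us where "us \<in> blocks ns" "U = diag_block_mat us"
    using U by (auto simp: normalizer_def multi_matrix_algebra_def)
  then have zU: "z * U = U * z" unfolding z_def using single_block_one_central[OF _ i] by simp
  note closed = mult_carrier_mat[of _ ?N ?N _ ?N]
  note assoc = assoc_mult_mat[of _ ?N ?N _ ?N _ ?N]
  have "mat_trace (z * (U * p j * V)) = mat_trace (V * (z * U * p j))"
    using mat_trace_comm[of "z * U * p j" ?N ?N V] by (simp add: assoc closed zC UC VC pC[OF j])
  also have "V * (z * U * p j) = V * U * (z * p j)"
    unfolding zU by (simp add: assoc closed zC UC VC pC[OF j])
  also have "\<dots> = z * p j" unfolding UV by (rule left_mult_one_mat[OF closed[OF zC pC[OF j]]])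
  finally have tr: "mat_trace (z * (U * p j * V)) = of_nat (L $$ (i, j) * ms ! j)"
    using tr_zp[OF j] by simp
  have "\<alpha> * mat_trace (z * p k) = mat_trace (z * (\<alpha> \<cdot>\<^sub>m p k))"
    by (simp add: mult_smult_distrib[OF zC pC[OF k]] mat_trace_smult[OF closed[OF zC pC[OF k]]])
  also have "\<dots> = \<beta> * mat_trace (z * (U * p j * V))"
    unfolding eq using closed[OF closed[OF UC pC[OF j]] VC]
    by (simp add: mult_smult_distrib[OF zC] mat_trace_smult[OF closed[OF zC]])
  finally have "\<alpha> * of_nat (L $$ (i, k) * ms ! k) = \<beta> * of_nat (L $$ (i, j) * ms ! j)"
    unfolding tr tr_zp[OF k] .
  \<comment> \<open>If \<open>L $$ (i, j)\<close> were 0, the right-hand side of the trace identity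
    would vanish while the left one does not.\<close>
  moreover have "\<alpha> * of_nat (L $$ (i, k) * ms ! k) \<noteq> 0"
    using \<alpha> nz(3) ms_pos[OF k] by simp
  ultimately show ?thesis by (metis mult_zero_left mult_zero_right of_nat_0)
qed

section \<open>The norm bound\<close>

text \<open>Cauchy-Schwarz for the factors sqrt (a u) and sqrt (a / u) x. Where u = 0,
  \<open>support\<close> forces a = 0, and both sides contribute 0 by the convention for division by
  zero.\<close>

lemma weighted_Cauchy_Schwarz:
  fixes a u x :: "'a \<Rightarrow> real"
  assumes a: "\<And>j. j \<in> J \<Longrightarrow> 0 \<le> a j" and u: "\<And>j. j \<in> J \<Longrightarrow> 0 \<le> u j"
    and support: "\<And>j. j \<in> J \<Longrightarrow> u j = 0 \<Longrightarrow> a j = 0"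
  shows "(\<Sum>j\<in>J. a j * x j)\<^sup>2 \<le> (\<Sum>j\<in>J. a j * u j) * (\<Sum>j\<in>J. a j * ((x j)\<^sup>2 / u j))"
proof -
  have "(\<Sum>j\<in>J. a j * x j) = (\<Sum>j\<in>J. sqrt (a j * u j) * (sqrt (a j / u j) * x j))"
  proof (rule sum.cong)
    fix j assume j: "j \<in> J"
    show "a j * x j = sqrt (a j * u j) * (sqrt (a j / u j) * x j)"
    proof (cases "u j = 0")
      case False
      then have "sqrt (a j * u j) * sqrt (a j / u j) = sqrt ((a j)\<^sup>2)"
        by (simp add: real_sqrt_mult[symmetric] power2_eq_square)
      then show ?thesis using a[OF j] by (simp add: mult.assoc[symmetric])
    qed (simp add: support[OF j])
  qed simp
  also have "\<dots>\<^sup>2 \<le> (\<Sum>j\<in>J. (sqrt (a j * u j))\<^sup>2) * (\<Sum>j\<in>J. (sqrt (a j / u j) * x j)\<^sup>2)"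
    by (rule Cauchy_Schwarz_ineq_sum)
  also have "(\<Sum>j\<in>J. (sqrt (a j * u j))\<^sup>2) = (\<Sum>j\<in>J. a j * u j)"
    using a u by (intro sum.cong) auto
  also have "(\<Sum>j\<in>J. (sqrt (a j / u j) * x j)\<^sup>2) = (\<Sum>j\<in>J. a j * ((x j)\<^sup>2 / u j))"
    using a u by (intro sum.cong) (auto simp: power_mult_distrib)
  finally show ?thesis .
qed

text \<open>Weighted Cauchy-Schwarz bounds each row by (A u) times a sum with weights 1 / u. After
  exchanging the sums, the factor A^t A u is bounded by q u, which cancels the weights.\<close>

lemma schur_test_column_sums:
  fixes a :: "'a \<Rightarrow> 'b \<Rightarrow> real" and x :: "'b \<Rightarrow> real"
  assumes I: "finite I" and q: "0 \<le> q"
    and a: "\<And>i j. i \<in> I \<Longrightarrow> j \<in> J \<Longrightarrow> 0 \<le> a i j"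
    and bound: "\<And>i j. i \<in> I \<Longrightarrow> j \<in> J \<Longrightarrow> (\<Sum>l\<in>I. (\<Sum>k\<in>J. a i k * a l k) * a l j) \<le> q * a i j"
  shows "(\<Sum>i\<in>I. (\<Sum>j\<in>J. a i j * x j)\<^sup>2) \<le> q * (\<Sum>j\<in>J. (x j)\<^sup>2)"
proof -
  define u where "u = (\<lambda>j. \<Sum>i\<in>I. a i j)"
  have u: "0 \<le> u j" if "j \<in> J" for j unfolding u_def using a that by (intro sum_nonneg) auto
  have support: "a i j = 0" if "i \<in> I" "j \<in> J" "u j = 0" for i j
    using that a I by (simp add: u_def sum_nonneg_eq_0_iff)
  have u_bound: "(\<Sum>l\<in>I. (\<Sum>k\<in>J. a l k * u k) * a l j) \<le> q * u j" if j: "j \<in> J" for j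
  proof -
    have "(\<Sum>l\<in>I. (\<Sum>k\<in>J. a l k * u k) * a l j) = (\<Sum>l\<in>I. \<Sum>i\<in>I. (\<Sum>k\<in>J. a i k * a l k) * a l j)"
    proof (rule sum.cong)
      fix l
      \<comment> \<open>As \<open>u\<close> is itself a sum over rows, entry l of A u is the l-th
        column sum of A A^t; this brings in the triple product of \<open>bound\<close>.\<close>
      have "(\<Sum>k\<in>J. a l k * u k) = (\<Sum>i\<in>I. \<Sum>k\<in>J. a i k * a l k)"
        unfolding u_def sum_distrib_left by (subst sum.swap) (simp add: mult.commute)
      then show "(\<Sum>k\<in>J. a l k * u k) * a l j = (\<Sum>i\<in>I. (\<Sum>k\<in>J. a i k * a l k) * a l j)"
        by (simp add: sum_distrib_right)
    qed simp
    also have "\<dots> = (\<Sum>i\<in>I. \<Sum>l\<in>I. (\<Sum>k\<in>J. a i k * a l k) * a l j)" by (rule sum.swap)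
    also have "\<dots> \<le> (\<Sum>i\<in>I. q * a i j)" using bound j by (intro sum_mono) auto
    finally show ?thesis by (simp add: u_def sum_distrib_left)
  qed
  have "(\<Sum>i\<in>I. (\<Sum>j\<in>J. a i j * x j)\<^sup>2)
      \<le> (\<Sum>i\<in>I. (\<Sum>k\<in>J. a i k * u k) * (\<Sum>j\<in>J. a i j * ((x j)\<^sup>2 / u j)))"
    using a u support by (intro sum_mono weighted_Cauchy_Schwarz) auto
  also have "\<dots> = (\<Sum>i\<in>I. \<Sum>j\<in>J. (\<Sum>k\<in>J. a i k * u k) * a i j * ((x j)\<^sup>2 / u j))"
    by (simp add: sum_distrib_left mult.assoc)
  also have "\<dots> = (\<Sum>j\<in>J. (\<Sum>i\<in>I. (\<Sum>k\<in>J. a i k * u k) * a i j) * ((x j)\<^sup>2 / u j))"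
    by (subst sum.swap) (simp only: sum_distrib_right)
  also have "\<dots> \<le> (\<Sum>j\<in>J. q * (x j)\<^sup>2)"
  proof (rule sum_mono)
    fix j assume j: "j \<in> J"
    show "(\<Sum>i\<in>I. (\<Sum>k\<in>J. a i k * u k) * a i j) * ((x j)\<^sup>2 / u j) \<le> q * (x j)\<^sup>2"
    proof (cases "u j = 0")
      \<comment> \<open>Division by zero yields 0, so the left-hand side vanishes.\<close>
      case True
      then show ?thesis using q by simp
    next
      case False
      then have "(\<Sum>i\<in>I. (\<Sum>k\<in>J. a i k * u k) * a i j) * ((x j)\<^sup>2 / u j) \<le> q * u j * ((x j)\<^sup>2 / u j)"
        using u_bound[OF j] u[OF j] by (intro mult_right_mono) auto
      then show ?thesis using False by simp
    qed
  qed
  finally show ?thesis by (simp add: sum_distrib_left)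
qed

section \<open>From the quadratic estimate to the operator norm\<close>

lemma vec_norm2_eq: "vec_norm2 v = sqrt (\<Sum>i<dim_vec v. (v $ i)\<^sup>2)"
  by (simp add: vec_norm2_def scalar_prod_def power2_eq_square lessThan_atLeast0)

lemma mat_op_norm_square_le:
  assumes q: "0 \<le> q"
    and bound: "\<And>x. (\<Sum>i<dim_row M. (\<Sum>j<dim_col M. M $$ (i, j) * x j)\<^sup>2) \<le> q * (\<Sum>j<dim_col M. (x j)\<^sup>2)"
  shows "(mat_op_norm M)\<^sup>2 \<le> q"
proof -
  let ?S = "{v \<in> carrier_vec (dim_col M). vec_norm2 v \<le> 1}"
  have le: "vec_norm2 (M *\<^sub>v v) \<le> sqrt q" if v: "v \<in> ?S" for v
  proof -
    have dim: "dim_vec v = dim_col M" using v by auto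
    have "vec_norm2 (M *\<^sub>v v) = sqrt (\<Sum>i<dim_row M. (\<Sum>j<dim_col M. M $$ (i, j) * v $ j)\<^sup>2)"
      using dim unfolding vec_norm2_eq by (simp add: scalar_prod_def lessThan_atLeast0)
    also have "\<dots> \<le> sqrt (q * (\<Sum>j<dim_col M. (v $ j)\<^sup>2))" by (intro real_sqrt_le_mono bound)
    also have "\<dots> = sqrt q * vec_norm2 v" using dim by (simp add: vec_norm2_eq real_sqrt_mult)
    also have "\<dots> \<le> sqrt q" using v q by (intro mult_left_le) auto
    finally show ?thesis .
  qed
  have zero: "0\<^sub>v (dim_col M) \<in> ?S" by (simp add: vec_norm2_eq)
  have "mat_op_norm M \<le> sqrt q"
    unfolding mat_op_norm_def using zero le by (intro cSUP_least) blast+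
  \<comment> \<open>Squaring the bound requires a nonnegative supremum. The zero vector witnesses
    this, once the set is known to be bounded above.\<close>
  moreover have "0 \<le> mat_op_norm M"
    unfolding mat_op_norm_def
  proof (rule cSUP_upper2[OF _ zero])
    show "bdd_above ((\<lambda>v. vec_norm2 (M *\<^sub>v v)) ` ?S)" using le by (intro bdd_aboveI2)
    show "0 \<le> vec_norm2 (M *\<^sub>v 0\<^sub>v (dim_col M))" by (simp add: vec_norm2_eq sum_nonneg)
  qed
  ultimately have "(mat_op_norm M)\<^sup>2 \<le> (sqrt q)\<^sup>2" by (intro power_mono)
  then show ?thesis using q by simp
qed

section \<open>The product \<open>L L\<^sup>t L\<close>\<close>

lemma index_triple_product:
  fixes L :: "'a::comm_semiring_0 mat"
  assumes "L \<in> carrier_mat s r" "i < s" "j < r"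
  shows "(L * transpose_mat L * L) $$ (i, j) = (\<Sum>l<s. (\<Sum>k<r. L $$ (i, k) * L $$ (l, k)) * L $$ (l, j))"
proof -
  have "(L * transpose_mat L) $$ (i, l) = (\<Sum>k<r. L $$ (i, k) * L $$ (l, k))" if "l < s" for l
    using assms that by (simp add: scalar_prod_def lessThan_atLeast0)
  then show ?thesis using assms by (simp add: scalar_prod_def lessThan_atLeast0 del: assoc_mult_mat)
qed

text \<open>A nonzero term of entry (i, j) of the triple product is a chain of nonzero entries (i,
  k), (l, k), (l, j), so \<open>support\<close> makes \<open>L $$ (i, j)\<close> nonzero. There the
  natural number \<open>L $$ (i, j)\<close> is at least 1, and a large enough q works
  uniformly.\<close>

lemma triple_product_le_smult:
  fixes L :: "nat mat"
  assumes L: "L \<in> carrier_mat s r"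
    and support: "\<And>i j k l. i < s \<Longrightarrow> l < s \<Longrightarrow> j < r \<Longrightarrow> k < r \<Longrightarrow>
      L $$ (l, j) \<noteq> 0 \<Longrightarrow> L $$ (l, k) \<noteq> 0 \<Longrightarrow> L $$ (i, k) \<noteq> 0 \<Longrightarrow> L $$ (i, j) \<noteq> 0"
  shows "\<exists>q>0. L * transpose_mat L * L \<le> q \<cdot>\<^sub>m L"
proof -
  let ?T = "L * transpose_mat L * L"
  \<comment> \<open>The sum of all entries dominates each of them; \<open>Suc\<close> secures
    positivity.\<close>
  define q where "q = Suc (\<Sum>i<s. \<Sum>j<r. ?T $$ (i, j))"
  have entry: "?T $$ (i, j) \<le> q * L $$ (i, j)" if ij: "i < s" "j < r" for i j
  proof (cases "L $$ (i, j) = 0")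
    case True
    have "L $$ (i, k) * L $$ (l, k) * L $$ (l, j) = 0" if "l < s" "k < r" for k l
      using support[OF ij(1) that(1) ij(2) that(2)] True by auto
    then have "?T $$ (i, j) = 0"
      by (simp add: index_triple_product[OF L ij] sum_distrib_right)
    then show ?thesis by simp
  next
    case False
    have "?T $$ (i, j) \<le> (\<Sum>j<r. ?T $$ (i, j))"
      using ij(2) by (intro member_le_sum) auto
    also have "\<dots> \<le> (\<Sum>i<s. \<Sum>j<r. ?T $$ (i, j))"
      using ij(1) by (intro member_le_sum[where f = "\<lambda>i. \<Sum>j<r. ?T $$ (i, j)"]) auto
    also have "\<dots> \<le> q * 1" by (simp add: q_def)
    also have "\<dots> \<le> q * L $$ (i, j)" using False by (intro mult_le_mono2) simp
    finally show ?thesis .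
  qed
  have "?T \<le> q \<cdot>\<^sub>m L"
    unfolding less_eq_mat_def using L entry by (auto simp del: index_mult_mat(1))
  then show ?thesis by (intro exI[of _ q]) (simp add: q_def)
qed

theorem theorem4p7:
  fixes ns ms :: "nat list" and B :: "complex mat set" and L :: "nat mat"
  assumes "\<forall>n\<in>set ns. n > 0" and "\<forall>m\<in>set ms. m > 0"
    and "unital_star_subalgebra (sum_list ns) B (multi_matrix_algebra ns)"
    and "is_inclusion_matrix ns ms B L"
    and "regular_inclusion (sum_list ns) (multi_matrix_algebra ns) B"
  shows "has_depth L 2
    \<and> (\<exists>q>0. L * transpose_mat L * L \<le> q \<cdot>\<^sub>m L)
    \<and> (\<forall>q. L * transpose_mat L * L \<le> q \<cdot>\<^sub>m L \<longrightarrow>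
           real q \<ge> (mat_op_norm (map_mat real L))\<^sup>2)"
proof (intro conjI allI impI)
  have L: "L \<in> carrier_mat (length ns) (length ms)"
    using assms(4) by (simp add: is_inclusion_matrix_def)
  show ex: "\<exists>q>0. L * transpose_mat L * L \<le> q \<cdot>\<^sub>m L"
    by (rule triple_product_le_smult[OF L]) (rule regular_inclusion_support[OF assms(2-5)])
  \<comment> \<open>The recursion for \<open>alt_pow\<close> starts with an identity matrix on the
    left, which has to be cancelled.\<close>
  have powers: "alt_pow L (2 + 1) = L * transpose_mat L * L" "alt_pow L (2 - 1) = L"
    using left_mult_one_mat[OF L] L by (simp_all add: numeral_eq_Suc)
  have "depth_ineq L 2"
    unfolding depth_ineq_def powers by (rule ex)
  \<comment> \<open>Minimality is vacuous, since no k satisfies 2 \<le> k < 2.\<close>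
  then show "has_depth L 2"
    unfolding has_depth_def by force
  fix q assume q: "L * transpose_mat L * L \<le> q \<cdot>\<^sub>m L"
  let ?a = "\<lambda>i j. real (L $$ (i, j))"
  have bound: "(\<Sum>l<length ns. (\<Sum>k<length ms. ?a i k * ?a l k) * ?a l j) \<le> real q * ?a i j"
    if ij: "i < length ns" "j < length ms" for i j
  proof -
    have "(L * transpose_mat L * L) $$ (i, j) \<le> q * L $$ (i, j)"
      using q L ij unfolding less_eq_mat_def by (simp del: index_mult_mat(1))
    then have "real (\<Sum>l<length ns. (\<Sum>k<length ms. L $$ (i, k) * L $$ (l, k)) * L $$ (l, j)) \<le> real (q * L $$ (i, j))"
      unfolding index_triple_product[OF L ij] by (rule of_nat_mono)
    then show ?thesis by simp
  qed
  show "(mat_op_norm (map_mat real L))\<^sup>2 \<le> real q"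
  proof (rule mat_op_norm_square_le)
    fix x :: "nat \<Rightarrow> real"
    have "(\<Sum>i<length ns. (\<Sum>j<length ms. ?a i j * x j)\<^sup>2) \<le> real q * (\<Sum>j<length ms. (x j)\<^sup>2)"
      using bound by (intro schur_test_column_sums) auto
    then show "(\<Sum>i<dim_row (map_mat real L). (\<Sum>j<dim_col (map_mat real L). map_mat real L $$ (i, j) * x j)\<^sup>2)
        \<le> real q * (\<Sum>j<dim_col (map_mat real L). (x j)\<^sup>2)"
      using L by simp
  qed simp
qed

end
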